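(* Let $E$ be a finite-dimensional real affine space, let $\mathcal{A}=(A_1,A_2,A_3)$ be an ordered family of three distinct points of $E$, let $t=(t_1,t_2,t_3)\in(0,1)^3$ with $t_1,t_2,t_3$ not all equal, and let $\mathfrak{B}$ be the $t$-barypolygonal sequence of $\mathcal{A}$. Then the dual sequence $(G_m)_{m\in\mathbb{N}}$ of $\mathfrak{B}$ converges exponentially to the centroid $G$ of $\mathcal{A}$ (barycenter of $A_1,A_2,A_3$ with equal weights); that is, for a norm $\|\cdot\|$ on the direction of $E$, there exist constants $C>0$ and $\rho\in(0,1)$ such that $\|\overrightarrow{GG_m}\|\leq C\rho^m$ for all $m\in\mathbb{N}$.
   Context: Let $p\geq 2$, let $\mathcal{A}=(A_1,\dots,A_p)$ be an ordered family of distinct points of a finite-dimensional real affine space $E$, and let $t=(t_1,\dots,t_p)\in(0,1)^p$. The $t$-barypolygone of an ordered family $(M_1,\dots,M_p)$ of points is the family $(N_1,\dots,N_p)$ where $N_k$ is the barycenter of $M_k$ with weight $t_k$ and $M_{k+1}$ with weight $1-t_k$ (indices cyclic, $M_{p+1}=M_1$). The $t$-barypolygonal sequence of $\mathcal{A}$ is $\mathfrak{B}=(\mathcal{B}_n)_{n\in\mathbb{N}}$ with $\mathcal{B}_0=\mathcal{A}$ and $\mathcal{B}_{n+1}$ the $t$-barypolygone of $\mathcal{B}_n$. It is known that all $p$ vertices of $\mathcal{B}_n$ converge, as $n\to\infty$, to the same point, the barycenter of the points $A_k$ with weights $\frac{1}{1-t_k}$ (equivalently with weights $\prod_{i\neq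 k}(1-t_i)$), $1\leq k\leq p$; this point is called the limit of $\mathfrak{B}$. The derived system of $\mathfrak{B}$ is the sequence $(t^{(m)})_{m\in\mathbb{N}}$ in $(0,1)^p$, $t^{(m)}=(t^{(m)}_1,\dots,t^{(m)}_p)$, defined by $t^{(0)}=t$ and $t^{(m+1)}_k=\prod_{1\leq i\leq p,\ i\neq k}\bigl(1-t^{(m)}_i\bigr)$ for $1\leq k\leq p$. The dual sequence of $\mathfrak{B}$ is $(G_m)_{m\in\mathbb{N}}$, where $G_m$ is the limit of the $t^{(m)}$-barypolygonal sequence of $\mathcal{A}$, i.e. the barycenter of the $A_k$ with weights $\frac{1}{1-t^{(m)}_k}$. *)

theory Defs
  imports "HOL-Analysis.Analysis"
begin

text \<open>
  A family of \<open>p\<close> points or reals is a function on \<^typ>\<open>nat\<close> of which only the values at the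
  indices \<open>1, \<dots>, p\<close> are relevant. An affine space is identified with its direction
  by the choice of an origin.
\<close>

definition barycenter :: "'i set \<Rightarrow> ('i \<Rightarrow> real) \<Rightarrow> ('i \<Rightarrow> 'a) \<Rightarrow> 'a::real_vector" where
  "barycenter I w A = (\<Sum>k\<in>I. w k *\<^sub>R A k) /\<^sub>R (\<Sum>k\<in>I. w k)"

definition cyclic_succ :: "nat \<Rightarrow> nat \<Rightarrow> nat" where
  "cyclic_succ p k = (if k = p then 1 else Suc k)"

text \<open>The weights \<open>t\<^sub>k\<close> and \<open>1 - t\<^sub>k\<close> add up to 1, so no normalisation is needed.\<close>

definition barypolygone :: "nat \<Rightarrow> (nat \<Rightarrow> real) \<Rightarrow> (nat \<Rightarrow> 'a) \<Rightarrow> nat \<Rightarrow> 'a::real_vector" where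
  "barypolygone p t M = (\<lambda>k. t k *\<^sub>R M k + (1 - t k) *\<^sub>R M (cyclic_succ p k))"

primrec barypolygonal_seq ::
  "nat \<Rightarrow> (nat \<Rightarrow> real) \<Rightarrow> (nat \<Rightarrow> 'a) \<Rightarrow> nat \<Rightarrow> nat \<Rightarrow> 'a::real_vector" where
  "barypolygonal_seq p t A 0 = A"
| "barypolygonal_seq p t A (Suc n) = barypolygone p t (barypolygonal_seq p t A n)"

text \<open>
  For \<open>p \<ge> 2\<close> and all \<open>t\<^sub>k\<close> in \<open>(0,1)\<close>, the vertices have a common limit, namely the barycenter
  with weights \<open>1 / (1 - t\<^sub>k)\<close>; outside this range the value may be unspecified.
\<close>

definition barypolygonal_limit ::
  "nat \<Rightarrow> (nat \<Rightarrow> real) \<Rightarrow> (nat \<Rightarrow> 'a) \<Rightarrow> 'a::real_normed_vector" where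
  "barypolygonal_limit p t A =
    (THE L. \<forall>k\<in>{1..p}. (\<lambda>n. barypolygonal_seq p t A n k) \<longlonglongrightarrow> L)"

primrec derived_system :: "nat \<Rightarrow> (nat \<Rightarrow> real) \<Rightarrow> nat \<Rightarrow> nat \<Rightarrow> real" where
  "derived_system p t 0 = t"
| "derived_system p t (Suc m) = (\<lambda>k. \<Prod>i\<in>{1..p} - {k}. 1 - derived_system p t m i)"

definition dual_seq ::
  "nat \<Rightarrow> (nat \<Rightarrow> real) \<Rightarrow> (nat \<Rightarrow> 'a) \<Rightarrow> nat \<Rightarrow> 'a::real_normed_vector" where
  "dual_seq p t A m = barypolygonal_limit p (derived_system p t m) A"

definition centroid :: "nat \<Rightarrow> (nat \<Rightarrow> 'a) \<Rightarrow> 'a::real_vector" where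
  "centroid p A = barycenter {1..p} (\<lambda>_. 1) A"

end

theory Submission
  imports Defs
begin

text \<open>
  Write \<open>s k = 1 - t\<^sup>(\<^sup>m\<^sup>) k\<close>. The limit of the barypolygonal sequence is the barycenter with weights
  \<open>1 / s k\<close>, so the claim is that the three weights become equal \<^emph>\<open>relative to each other\<close>,
  exponentially fast. This is not a matter of convergence of \<open>s\<close>: near the diagonal
  the map behaves like \<open>x \<mapsto> 1 - x\<^sup>2\<close>, which has an attracting cycle alternating between \<open>0\<close> and \<open>1\<close>,
  so the \<open>s k\<close> can become arbitrarily small, and differences of the \<open>s k\<close> can
  shrink by a factor close to \<open>1\<close> in every other step.

  Both difficulties disappear when two steps are taken at once. For \<open>{i, j, k} = {1, 2, 3}\<close> and
  \<open>a = s k * (1 - s i * s j)\<close> the values two steps later are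
  \<open>s'' i = s i * (s j + a)\<close> and \<open>s'' j = s j * (s i + a)\<close>, so that \<open>s'' i - s'' j = a * (s i - s j)\<close>.
  Hence a bound \<open>R\<close> on all ratios \<open>s i / s j\<close> persists, and the relative difference
  \<open>(s i - s j) / s i\<close> is multiplied by \<open>a / (s j + a) \<le> R / (1 + R) < 1\<close>, because
  \<open>a \<le> s k \<le> R * s j\<close>. This is carried by \<open>two_step_contraction\<close> and iterated in
  \<open>relative_difference_decay\<close>.

  That the vertices converge to the barycenter is proved for real-valued families first. The sum of
  the \<open>x k / (1 - t k)\<close> is invariant, and the energy, the sum of the \<open>(x k)\<^sup>2 / (1 - t k)\<close>, drops in
  each step by the sum of the \<open>t k * (x k - x (k + 1))\<^sup>2\<close>. As the energy is nonnegative,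
  neighbouring vertices approach each other, and the invariant identifies the common limit.
  Expanding a family of vectors in coefficients with respect to its own points transfers this to
  any normed space.
\<close>

section \<open>The limit of a barypolygonal sequence\<close>

lemma cyclic_succ_in:
  "k \<in> {1..p} \<Longrightarrow> cyclic_succ p k \<in> {1..p}"
  by (auto simp: cyclic_succ_def)

lemma bij_betw_cyclic_succ: "bij_betw (cyclic_succ p) {1..p} {1..p}"
proof -
  have "inj_on (cyclic_succ p) {1..p}"
    by (auto simp: inj_on_def cyclic_succ_def split: if_splits)
  then show ?thesis
    using cyclic_succ_in by (intro bij_betw_imageI endo_inj_surj) auto
qed

lemma sum_cyclic_succ:
  fixes f :: "nat \<Rightarrow> 'a::comm_monoid_add"
  shows "(\<Sum>k\<in>{1..p}. f (cyclic_succ p k)) = (\<Sum>k\<in>{1..p}. f k)"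
  by (rule sum.reindex_bij_betw[OF bij_betw_cyclic_succ])

lemma weighted_sum_barypolygone:
  fixes x :: "nat \<Rightarrow> real"
  assumes "\<And>k. k \<in> {1..p} \<Longrightarrow> t k \<noteq> 1"
  shows "(\<Sum>k\<in>{1..p}. barypolygone p t x k / (1 - t k)) = (\<Sum>k\<in>{1..p}. x k / (1 - t k))"
proof -
  have "(\<Sum>k\<in>{1..p}. barypolygone p t x k / (1 - t k))
      = (\<Sum>k\<in>{1..p}. (x k / (1 - t k) - x k) + x (cyclic_succ p k))"
    using assms by (intro sum.cong) (auto simp: barypolygone_def field_simps)
  also have "\<dots> = (\<Sum>k\<in>{1..p}. x k / (1 - t k))"
    by (simp add: sum.distrib sum_subtractf sum_cyclic_succ[of x] del: One_nat_def)
  finally show ?thesis .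
qed

text \<open>
  The quantitative form of convexity of the square,
  \<open>(t * x + (1 - t) * y)\<^sup>2 = t * x\<^sup>2 + (1 - t) * y\<^sup>2 - t * (1 - t) * (x - y)\<^sup>2\<close>, summed up with the weights
  under which the first two terms reassemble to the old energy.
\<close>

lemma energy_barypolygone:
  fixes x :: "nat \<Rightarrow> real"
  assumes "\<And>k. k \<in> {1..p} \<Longrightarrow> t k \<noteq> 1"
  shows "(\<Sum>k\<in>{1..p}. (barypolygone p t x k)\<^sup>2 / (1 - t k))
       = (\<Sum>k\<in>{1..p}. (x k)\<^sup>2 / (1 - t k)) - (\<Sum>k\<in>{1..p}. t k * (x k - x (cyclic_succ p k))\<^sup>2)"
proof -
  have "(\<Sum>k\<in>{1..p}. (barypolygone p t x k)\<^sup>2 / (1 - t k))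
      = (\<Sum>k\<in>{1..p}. ((x k)\<^sup>2 / (1 - t k) - (x k)\<^sup>2) + (x (cyclic_succ p k))\<^sup>2
          - t k * (x k - x (cyclic_succ p k))\<^sup>2)"
  proof (rule sum.cong[OF refl])
    fix k assume "k \<in> {1..p}"
    then have "1 - t k \<noteq> 0" using assms by auto
    then show "(barypolygone p t x k)\<^sup>2 / (1 - t k)
        = ((x k)\<^sup>2 / (1 - t k) - (x k)\<^sup>2) + (x (cyclic_succ p k))\<^sup>2
          - t k * (x k - x (cyclic_succ p k))\<^sup>2"
      by (simp add: barypolygone_def divide_simps) algebra
  qed
  also have "\<dots> = (\<Sum>k\<in>{1..p}. (x k)\<^sup>2 / (1 - t k))
      - (\<Sum>k\<in>{1..p}. t k * (x k - x (cyclic_succ p k))\<^sup>2)"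
    by (simp add: sum.distrib sum_subtractf sum_cyclic_succ[of "\<lambda>k. (x k)\<^sup>2"] del: One_nat_def)
  finally show ?thesis .
qed

lemma neighbours_approach:
  fixes x :: "nat \<Rightarrow> real"
  assumes t: "\<And>k. k \<in> {1..p} \<Longrightarrow> 0 < t k \<and> t k < 1" and k: "k \<in> {1..p}"
  shows "(\<lambda>n. barypolygonal_seq p t x n k - barypolygonal_seq p t x n (cyclic_succ p k))
           \<longlonglongrightarrow> 0"
proof -
  let ?x = "barypolygonal_seq p t x"
  define V where "V n = (\<Sum>j\<in>{1..p}. (?x n j)\<^sup>2 / (1 - t j))" for n
  define L where "L n = (\<Sum>j\<in>{1..p}. t j * (?x n j - ?x n (cyclic_succ p j))\<^sup>2)" for n
  have step: "V (Suc n) = V n - L n" for n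
    unfolding V_def L_def using t
    by (subst energy_barypolygone[symmetric]) (auto dest: less_imp_neq)
  have L_nonneg: "0 \<le> L n" for n
    unfolding L_def using t by (intro sum_nonneg mult_nonneg_nonneg) (auto simp: less_imp_le)
  have V_nonneg: "0 \<le> V n" for n
    unfolding V_def using t by (intro sum_nonneg divide_nonneg_nonneg) (auto simp: less_imp_le)
  have "decseq V"
    using step L_nonneg by (intro decseq_SucI) (simp add: step)
  then obtain l where "V \<longlonglongrightarrow> l"
    using decseq_convergent V_nonneg by blast
  then have "(\<lambda>n. V n - V (Suc n)) \<longlonglongrightarrow> l - l"
    by (intro tendsto_diff LIMSEQ_Suc)
  then have L0: "L \<longlonglongrightarrow> 0"
    by (simp add: step)
  have bound: "norm ((?x n k - ?x n (cyclic_succ p k))\<^sup>2) \<le> L n / t k" for n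
  proof -
    have "t k * (?x n k - ?x n (cyclic_succ p k))\<^sup>2 \<le> L n"
      unfolding L_def using t k
      by (intro member_le_sum mult_nonneg_nonneg) (auto simp: less_imp_le)
    then show ?thesis
      using t[OF k] by (simp add: field_simps)
  qed
  have "(\<lambda>n. (?x n k - ?x n (cyclic_succ p k))\<^sup>2) \<longlonglongrightarrow> 0"
    by (rule Lim_null_comparison[OF always_eventually[OF allI[OF bound]] tendsto_divide_zero[OF L0]])
  then show ?thesis
    by simp
qed

lemma barypolygonal_seq_real_tendsto:
  fixes x :: "nat \<Rightarrow> real"
  assumes t: "\<And>k. k \<in> {1..p} \<Longrightarrow> 0 < t k \<and> t k < 1" and k: "k \<in> {1..p}"
  shows "(\<lambda>n. barypolygonal_seq p t x n k) \<longlonglongrightarrow> barycenter {1..p} (\<lambda>k. 1 / (1 - t k)) x"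
proof -
  let ?x = "barypolygonal_seq p t x"
  define W where "W = (\<Sum>j\<in>{1..p}. 1 / (1 - t j))"
  define S where "S = (\<Sum>j\<in>{1..p}. x j / (1 - t j))"
  have "W > 0"
    unfolding W_def using t k by (intro sum_pos) auto
  have inv: "(\<Sum>j\<in>{1..p}. ?x n j / (1 - t j)) = S" for n
  proof (induction n)
    case (Suc n)
    then show ?case
      using weighted_sum_barypolygone[of p t "?x n"] t by force
  qed (simp add: S_def)
  have to_first: "(\<lambda>n. ?x n j - ?x n 1) \<longlonglongrightarrow> 0" if "j \<in> {1..p}" for j
    using that
  proof (induction j)
    case (Suc j)
    show ?case
    proof (cases "j = 0")
      case False
      then have j: "j \<in> {1..p}" "j \<noteq> p" using Suc.prems by auto
      have "(\<lambda>n. (?x n j - ?x n 1) - (?x n j - ?x n (cyclic_succ p j))) \<longlonglongrightarrow> 0 - 0"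
        using Suc.IH j neighbours_approach[of p t j x, OF t] by (intro tendsto_diff) auto
      then show ?thesis using j by (simp add: cyclic_succ_def)
    qed simp
  qed simp
  have "(\<lambda>n. ?x n k - ?x n j) \<longlonglongrightarrow> 0" if "j \<in> {1..p}" for j
    using tendsto_diff[OF to_first[OF k] to_first[OF that]] by simp
  then have "(\<lambda>n. \<Sum>j\<in>{1..p}. (?x n k - ?x n j) / (1 - t j)) \<longlonglongrightarrow> 0"
    by (intro tendsto_null_sum tendsto_divide_zero) auto
  moreover have "(\<Sum>j\<in>{1..p}. (?x n k - ?x n j) / (1 - t j)) = ?x n k * W - S" for n
    by (simp add: inv diff_divide_distrib sum_subtractf W_def sum_distrib_left
        del: One_nat_def)
  ultimately have "(\<lambda>n. (?x n k * W - S) / W + S / W) \<longlonglongrightarrow> 0 / W + S / W"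
    by (intro tendsto_intros) (use \<open>W > 0\<close> in auto)
  then have "(\<lambda>n. ?x n k) \<longlonglongrightarrow> S / W"
    using \<open>W > 0\<close> by (simp add: diff_divide_distrib)
  then show ?thesis
    by (simp add: barycenter_def S_def W_def field_simps)
qed

text \<open>
  Every vertex is a linear combination of the initial points whose coefficients are themselves
  barypolygonal sequences, started at the unit vectors.
\<close>

lemma barypolygonal_seq_expansion:
  fixes A :: "nat \<Rightarrow> 'a::real_vector"
  assumes "k \<in> {1..p}"
  shows "barypolygonal_seq p t A n k
       = (\<Sum>j\<in>{1..p}. barypolygonal_seq p t (\<lambda>i. if i = j then 1 else 0 :: real) n k *\<^sub>R A j)"
  using assms
proof (induction n arbitrary: k)
  case 0
  then show ?case
    by (simp add: if_distrib[of "\<lambda>c. c *\<^sub>R _"] cong: if_cong)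
next
  case (Suc n)
  then show ?case
    using cyclic_succ_in[OF Suc.prems]
    by (simp add: barypolygone_def scaleR_right.sum scaleR_add_left sum.distrib)
qed

lemma barypolygonal_seq_tendsto:
  fixes A :: "nat \<Rightarrow> 'a::real_normed_vector"
  assumes t: "\<And>k. k \<in> {1..p} \<Longrightarrow> 0 < t k \<and> t k < 1" and k: "k \<in> {1..p}"
  shows "(\<lambda>n. barypolygonal_seq p t A n k) \<longlonglongrightarrow> barycenter {1..p} (\<lambda>k. 1 / (1 - t k)) A"
proof -
  let ?w = "\<lambda>k. 1 / (1 - t k)"
  let ?e = "\<lambda>j i. if i = j then 1 else 0 :: real"
  have "(\<lambda>n. \<Sum>j\<in>{1..p}. barypolygonal_seq p t (?e j) n k *\<^sub>R A j)
      \<longlonglongrightarrow> (\<Sum>j\<in>{1..p}. barycenter {1..p} ?w (?e j) *\<^sub>R A j)"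
    using barypolygonal_seq_real_tendsto[OF t k] by (intro tendsto_intros) auto
  moreover have "(\<Sum>j\<in>{1..p}. barycenter {1..p} ?w (?e j) *\<^sub>R A j) = barycenter {1..p} ?w A"
    by (simp add: barycenter_def scaleR_right.sum if_distrib[of "\<lambda>c. _ * c"] mult.commute
          divide_inverse cong: if_cong)
  ultimately show ?thesis
    by (simp add: barypolygonal_seq_expansion[OF k, of t A])
qed

lemma barypolygonal_limit_eq:
  fixes A :: "nat \<Rightarrow> 'a::real_normed_vector"
  assumes t: "\<And>k. k \<in> {1..p} \<Longrightarrow> 0 < t k \<and> t k < 1" and "p \<ge> 1"
  shows "barypolygonal_limit p t A = barycenter {1..p} (\<lambda>k. 1 / (1 - t k)) A"
  unfolding barypolygonal_limit_def
proof (rule the_equality)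
  show "\<forall>k\<in>{1..p}. (\<lambda>n. barypolygonal_seq p t A n k) \<longlonglongrightarrow> barycenter {1..p} (\<lambda>k. 1 / (1 - t k)) A"
    using barypolygonal_seq_tendsto[of p t, OF t] by blast
  fix L assume "\<forall>k\<in>{1..p}. (\<lambda>n. barypolygonal_seq p t A n k) \<longlonglongrightarrow> L"
  then have "(\<lambda>n. barypolygonal_seq p t A n 1) \<longlonglongrightarrow> L"
    using \<open>p \<ge> 1\<close> by simp
  moreover have "(\<lambda>n. barypolygonal_seq p t A n 1)
      \<longlonglongrightarrow> barycenter {1..p} (\<lambda>k. 1 / (1 - t k)) A"
    using barypolygonal_seq_tendsto[of p t 1 A, OF t] \<open>p \<ge> 1\<close> by simp
  ultimately show "L = barycenter {1..p} (\<lambda>k. 1 / (1 - t k)) A"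
    by (rule LIMSEQ_unique)
qed

section \<open>Barycenters with nearly equal weights\<close>

text \<open>
  Only differences relative to \<open>s\<close> matter: \<open>\<bar>1 / s k - 1 / s j\<bar> \<le> D / s j\<close>, and summing over \<open>j\<close>
  gives \<open>D\<close> times the total weight, which the normalisation cancels. So no lower bound on
  the \<open>s k\<close> enters.
\<close>

lemma barycenter_minus_centroid_le:
  fixes A :: "nat \<Rightarrow> 'a::real_normed_vector"
  assumes s: "\<And>k. k \<in> {1..p} \<Longrightarrow> 0 < s k" and "p \<ge> 1"
    and D: "\<And>i j. i \<in> {1..p} \<Longrightarrow> j \<in> {1..p} \<Longrightarrow> \<bar>s i - s j\<bar> \<le> D * s i"
  shows "norm (barycenter {1..p} (\<lambda>k. 1 / s k) A - centroid p A)
       \<le> D * ((\<Sum>k\<in>{1..p}. norm (A k)) / p)"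
proof -
  define W where "W = (\<Sum>j\<in>{1..p}. 1 / s j)"
  have "W > 0"
    unfolding W_def using s \<open>p \<ge> 1\<close> by (intro sum_pos) auto
  have weight: "\<bar>1 / s k / W - 1 / p\<bar> \<le> D / p" if k: "k \<in> {1..p}" for k
  proof -
    have "\<bar>p * (1 / s k) - W\<bar> = \<bar>\<Sum>j\<in>{1..p}. 1 / s k - 1 / s j\<bar>"
      by (simp add: W_def sum_subtractf)
    also have "\<dots> \<le> (\<Sum>j\<in>{1..p}. D * (1 / s j))"
    proof (intro order_trans[OF sum_abs] sum_mono)
      fix j assume j: "j \<in> {1..p}"
      have "\<bar>1 / s k - 1 / s j\<bar> = \<bar>s k - s j\<bar> / (s k * s j)"
        using s[OF j] s[OF k] by (simp add: diff_divide_eq_iff abs_div abs_mult abs_minus_commute)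
      also have "\<dots> \<le> D * s k / (s k * s j)"
        using s[OF j] s[OF k] D[OF k j] by (intro divide_right_mono) auto
      finally show "\<bar>1 / s k - 1 / s j\<bar> \<le> D * (1 / s j)"
        using s[OF k] by simp
    qed
    also have "\<dots> = D * W"
      by (simp add: W_def sum_distrib_left)
    finally have "\<bar>p * (1 / s k) - W\<bar> / (p * W) \<le> D * W / (p * W)"
      using \<open>W > 0\<close> by (intro divide_right_mono) auto
    moreover have "1 / s k / W - 1 / p = (p * (1 / s k) - W) / (p * W)"
      using \<open>W > 0\<close> \<open>p \<ge> 1\<close> by (simp add: diff_divide_distrib)
    ultimately show ?thesis
      using \<open>W > 0\<close> by (simp add: abs_div abs_mult)
  qed
  have "barycenter {1..p} (\<lambda>k. 1 / s k) A - centroid p A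
      = (\<Sum>k\<in>{1..p}. (1 / s k / W - 1 / p) *\<^sub>R A k)"
    by (simp add: barycenter_def centroid_def W_def scaleR_right.sum scaleR_diff_left sum_subtractf
          divide_inverse mult.commute)
  also have "norm \<dots> \<le> (\<Sum>k\<in>{1..p}. D / p * norm (A k))"
  proof (intro order_trans[OF norm_sum] sum_mono)
    fix k assume "k \<in> {1..p}"
    then show "norm ((1 / s k / W - 1 / p) *\<^sub>R A k) \<le> D / p * norm (A k)"
      unfolding norm_scaleR by (intro mult_right_mono weight) auto
  qed
  also have "\<dots> = D * ((\<Sum>k\<in>{1..p}. norm (A k)) / p)"
    by (simp add: sum_distrib_left sum_divide_distrib)
  finally show ?thesis .
qed

section \<open>The derived system\<close>

lemma derived_system_range:
  assumes t: "\<And>k. k \<in> {1..p} \<Longrightarrow> 0 < t k \<and> t k < 1" and "p \<ge> 2" and k: "k \<in> {1..p}"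
  shows "0 < derived_system p t m k \<and> derived_system p t m k < 1"
  using k
proof (induction m arbitrary: k)
  case (Suc m)
  let ?f = "\<lambda>i. 1 - derived_system p t m i"
  have f: "0 < ?f i \<and> ?f i < 1" if "i \<in> {1..p}" for i
    using Suc.IH[OF that] by simp
  have "(if k = 1 then 2 else 1) \<in> {1..p} - {k}"
    using \<open>p \<ge> 2\<close> by auto
  then obtain j where j: "j \<in> {1..p} - {k}" by blast
  have "prod ?f ({1..p} - {k}) = ?f j * prod ?f ({1..p} - {k} - {j})"
    using j by (intro prod.remove) auto
  also have "\<dots> \<le> ?f j * 1"
    using f j by (intro mult_left_mono prod_le_1) (auto simp: less_imp_le)
  also have "\<dots> < 1"
    using f j by auto
  finally have "prod ?f ({1..p} - {k}) < 1" .
  moreover have "0 < prod ?f ({1..p} - {k})"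
    using f by (intro prod_pos) auto
  ultimately show ?case by simp
qed (use t in auto)

lemma complement_derived_system_3:
  assumes "{1..3} = {i, j, k}" and "i \<noteq> j" "i \<noteq> k" "j \<noteq> k"
  shows "1 - derived_system 3 t (Suc m) i
       = 1 - (1 - derived_system 3 t m j) * (1 - derived_system 3 t m k)"
proof -
  have "{1..3} - {i} = {j, k}" using assms by auto
  then show ?thesis using assms by simp
qed

text \<open>
  Two steps of the derived system, for the values \<open>1 - t k\<close> in some order. With
  \<open>a = z * (1 - x * y)\<close> they turn \<open>x\<close> into \<open>x * y + x * a\<close> and \<open>y\<close> into \<open>x * y + y * a\<close>: the common
  summand \<open>x * y\<close> damps the difference, and it is not negligible because \<open>a \<le> z \<le> R * y\<close>.
\<close>

lemma two_step_contraction: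
  fixes x y z :: real
  assumes pos: "0 < x" "0 < y" "0 < z" and le1: "x < 1" "y < 1"
    and R: "1 \<le> R" "x \<le> R * y" "z \<le> R * y" and D: "0 \<le> D" "\<bar>x - y\<bar> \<le> D * x"
  defines "x'' \<equiv> 1 - (1 - x * z) * (1 - x * y)" and "y'' \<equiv> 1 - (1 - y * z) * (1 - x * y)"
  shows "x'' \<le> R * y''" and "\<bar>x'' - y''\<bar> \<le> D * (R / (1 + R)) * x''"
proof -
  define a where "a = z * (1 - x * y)"
  have x'': "x'' = x * (y + a)" and y'': "y'' = y * (x + a)"
    by (simp_all add: x''_def y''_def a_def algebra_simps)
  have "x * y < 1"
    using mult_strict_mono[of x 1 y 1] pos le1 by simp
  then have "0 \<le> a"
    using pos by (simp add: a_def)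
  have "1 * (x * y) \<le> R * (x * y)"
    using R pos by (intro mult_right_mono) auto
  moreover have "x * a \<le> (R * y) * a"
    using R \<open>0 \<le> a\<close> by (intro mult_right_mono) auto
  ultimately show "x'' \<le> R * y''"
    by (simp add: x'' y'' algebra_simps)
  have "a \<le> z"
    using pos by (simp add: a_def)
  then have "a \<le> R * y"
    using R by simp
  then have a: "a \<le> R / (1 + R) * (y + a)"
    using R by (simp add: field_simps)
  have "\<bar>x'' - y''\<bar> = \<bar>x - y\<bar> * a"
  proof -
    have "x'' - y'' = (x - y) * a" by (simp add: x'' y'' algebra_simps)
    then show ?thesis using \<open>0 \<le> a\<close> by (simp add: abs_mult)
  qed
  also have "\<dots> \<le> (D * x) * (R / (1 + R) * (y + a))"
    using D pos \<open>0 \<le> a\<close> by (intro mult_mono a) auto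
  finally show "\<bar>x'' - y''\<bar> \<le> D * (R / (1 + R)) * x''"
    by (simp add: x'' mult_ac)
qed

text \<open>
  The contraction concerns two steps at once, so even and odd indices evolve independently. Therefore
  one bound \<open>R\<close> has to cover the ratios at both indices \<open>0\<close> and \<open>1\<close>, and the rate per step is the
  square root of \<open>R / (1 + R)\<close>.
\<close>

lemma relative_difference_decay:
  assumes t: "\<And>k. k \<in> {1..3} \<Longrightarrow> 0 < t k \<and> t k < 1"
  obtains D \<rho> where "0 < D" and "0 < \<rho>" and "\<rho> < 1"
    and "\<And>m i j. i \<in> {1..3} \<Longrightarrow> j \<in> {1..3} \<Longrightarrow>
           \<bar>(1 - derived_system 3 t m i) - (1 - derived_system 3 t m j)\<bar>
             \<le> D * \<rho> ^ m * (1 - derived_system 3 t m i)"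
proof -
  define s where "s m k = 1 - derived_system 3 t m k" for m and k :: nat
  have s: "0 < s m k \<and> s m k < 1" if "k \<in> {1..3}" for m k
    using derived_system_range[of 3 t k m, OF t _ that] by (simp add: s_def)
  have step_eq: "s (Suc m) i = 1 - s m j * s m k"
    if "{1..3} = {i, j, k}" "i \<noteq> j" "i \<noteq> k" "j \<noteq> k" for m i j k
    using complement_derived_system_3[OF that] by (simp add: s_def)
  define e where "e = Min ((\<lambda>(m, k). s m k) ` ({0, 1} \<times> {1..3}))"
  have e_le: "e \<le> s m j" if "m \<in> {0, 1}" "j \<in> {1..3}" for m j
    unfolding e_def using that by (intro Min_le) force+
  have "0 < e"
    unfolding e_def using s by (subst Min_gr_iff) auto
  have "e < 1"
    using e_le[of 0 1] s[of 1 0] by simp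
  define R where "R = 1 / e"
  have "1 < R"
    using \<open>0 < e\<close> \<open>e < 1\<close> by (simp add: R_def)
  have initial: "s m i \<le> R * s m j \<and> \<bar>s m i - s m j\<bar> \<le> R * s m i"
    if "m \<in> {0, 1}" "i \<in> {1..3}" "j \<in> {1..3}" for m i j
  proof -
    have "1 \<le> R * s m l" if "l \<in> {1..3}" for l
      using e_le[OF \<open>m \<in> {0, 1}\<close> that] \<open>0 < e\<close> by (simp add: R_def)
    from this[OF that(2)] this[OF that(3)] s[OF that(2), of m] s[OF that(3), of m]
    show ?thesis by linarith
  qed
  define \<rho> where "\<rho> = sqrt (R / (1 + R))"
  have \<rho>: "0 < \<rho>" "\<rho> < 1" and \<rho>2: "R / (1 + R) = \<rho>\<^sup>2"
    using \<open>1 < R\<close> by (auto simp: \<rho>_def)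
  \<comment> \<open>The constant \<open>R / \<rho>\<close> makes the bound equal to \<open>R\<close> at index \<open>1\<close>, the later of the two starts.\<close>
  have "\<forall>i\<in>{1..3}. \<forall>j\<in>{1..3}. s m i \<le> R * s m j \<and> \<bar>s m i - s m j\<bar> \<le> R / \<rho> * \<rho> ^ m * s m i" for m
  proof (induction m rule: nat_induct2)
    case 0
    have "R * 1 \<le> R / \<rho>"
      using \<rho> \<open>1 < R\<close> by (simp add: field_simps)
    then have "R * s 0 i \<le> R / \<rho> * s 0 i" if "i \<in> {1..3}" for i
      using s[OF that, of 0] by (intro mult_right_mono) auto
    then show ?case
      using initial[of 0] by fastforce
  next
    case 1
    show ?case
      using initial[of 1] \<rho> by simp
  next
    case (step m)
    show ?case
    proof (intro ballI)
      fix i j :: nat assume i: "i \<in> {1..3}" and j: "j \<in> {1..3}"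
      show "s (m + 2) i \<le> R * s (m + 2) j
          \<and> \<bar>s (m + 2) i - s (m + 2) j\<bar> \<le> R / \<rho> * \<rho> ^ (m + 2) * s (m + 2) i"
      proof (cases "i = j")
        case True
        then show ?thesis
          using s[OF i, of "m + 2"] \<open>1 < R\<close> \<rho> by simp
      next
        case False
        have three: "{1..3} = {1, 2, 3::nat}" by auto
        have "\<exists>k\<in>{1, 2, 3}. {1, 2, 3} = {i, j, k} \<and> i \<noteq> k \<and> j \<noteq> k"
          using i j False unfolding three by (elim insertE emptyE) (simp_all add: insert_commute)
        then obtain k where k: "k \<in> {1..3}" and ijk: "{1..3} = {i, j, k}" "i \<noteq> k" "j \<noteq> k"
          unfolding three by blast
        have eqs: "s (m + 2) i = 1 - (1 - s m i * s m k) * (1 - s m i * s m j)"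
          "s (m + 2) j = 1 - (1 - s m j * s m k) * (1 - s m i * s m j)"
          using step_eq[of i j k] step_eq[of j i k] step_eq[of k i j] ijk False
          by (auto simp: insert_commute mult.commute)
        have "R / \<rho> * \<rho> ^ m * (R / (1 + R)) = R / \<rho> * \<rho> ^ (m + 2)"
          unfolding \<rho>2 by (simp add: power_add power2_eq_square)
        then show ?thesis
          using two_step_contraction[of "s m i" "s m j" "s m k" R "R / \<rho> * \<rho> ^ m"]
            s[OF i, of m] s[OF j, of m] s[OF k, of m] step[rule_format, OF i j]
            step[rule_format, OF k j] \<rho> \<open>1 < R\<close>
          unfolding eqs by simp
      qed
    qed
  qed
  then show thesis
    using \<rho> \<open>1 < R\<close> by (intro that[of "R / \<rho>" \<rho>]) (auto simp: s_def)
qed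

theorem mainTheorem3:
  fixes A :: "nat \<Rightarrow> 'a::real_normed_vector" and t :: "nat \<Rightarrow> real"
  assumes finite_dim: "\<exists>B::'a set. finite B \<and> span B = UNIV"
    and distinct_points: "inj_on A {1..3}"
    and t_range: "\<forall>k\<in>{1..3}. 0 < t k \<and> t k < 1"
    and not_all_equal: "\<not> (t 1 = t 2 \<and> t 2 = t 3)"
  shows "\<exists>C \<rho>. 0 < C \<and> 0 < \<rho> \<and> \<rho> < 1 \<and>
           (\<forall>m. norm (dual_seq 3 t A m - centroid 3 A) \<le> C * \<rho> ^ m)"
proof -
  have t: "0 < t k \<and> t k < 1" if "k \<in> {1..3}" for k
    using t_range that by blast
  have range: "0 < derived_system 3 t m k \<and> derived_system 3 t m k < 1" if "k \<in> {1..3}" for m k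
    using derived_system_range[of 3 t k m, OF t _ that] by simp
  obtain D \<rho> where "0 < D" and \<rho>: "0 < \<rho>" "\<rho> < 1"
    and decay: "\<And>m i j. i \<in> {1..3} \<Longrightarrow> j \<in> {1..3} \<Longrightarrow>
           \<bar>(1 - derived_system 3 t m i) - (1 - derived_system 3 t m j)\<bar>
             \<le> D * \<rho> ^ m * (1 - derived_system 3 t m i)"
    using relative_difference_decay[of t, OF t] by blast
  define N where "N = (\<Sum>k\<in>{1..3}. norm (A k)) / 3"
  have "0 \<le> N" unfolding N_def by (intro divide_nonneg_nonneg sum_nonneg) auto
  \<comment> \<open>The summand \<open>1\<close> keeps the constant positive.\<close>
  define C where "C = D * (N + 1)"
  have "norm (dual_seq 3 t A m - centroid 3 A) \<le> C * \<rho> ^ m" for m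
  proof -
    have "dual_seq 3 t A m = barycenter {1..3} (\<lambda>k. 1 / (1 - derived_system 3 t m k)) A"
      unfolding dual_seq_def using range by (intro barypolygonal_limit_eq) auto
    then have "norm (dual_seq 3 t A m - centroid 3 A) \<le> D * \<rho> ^ m * N"
      using barycenter_minus_centroid_le[of 3 "\<lambda>k. 1 - derived_system 3 t m k" "D * \<rho> ^ m" A]
        range decay by (simp add: N_def)
    also have "\<dots> \<le> D * \<rho> ^ m * (N + 1)"
      using \<open>0 < D\<close> \<rho> by (intro mult_left_mono) auto
    finally show ?thesis by (simp add: C_def mult_ac)
  qed
  moreover have "0 < C"
    using \<open>0 < D\<close> \<open>0 \<le> N\<close> by (simp add: C_def)
  ultimately show ?thesis using \<rho> by blast
qed

end
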